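(* For any $\varepsilon>0$ and any positive integer $n$, there exist instances of $3$-objective optimization problems such that $|P^{(2),*}|>n\cdot|P^*|$, where $P^{(2),*}$ denotes a minimum-cardinality quasi-$2$-exact $(1+\varepsilon)$-approximation set and $P^*$ denotes a minimum-cardinality ordinary $(1+\varepsilon)$-approximation set for the instance.
   Context: An instance $(X,f)$ of a $3$-objective optimization problem consists of a set $X$ of feasible solutions and $f=(f_1,f_2,f_3)$, $f_i:X\to\mathbb{Q}_{>0}$, all to be minimized; the set of image points $f(X)$ is finite. An ordinary $(1+\varepsilon)$-approximation set is a set $P\subseteq X$ such that for every $x'\in X$ there is $x\in P$ with $f_i(x)\le(1+\varepsilon)f_i(x')$ for $i=1,2,3$. A quasi-$2$-exact $(1+\varepsilon)$-approximation set is a set $P\subseteq X$ such that for every $x'\in X$ there is $x\in P$ and a set $S\subseteq\{1,2,3\}$ with $|S|=2$ (possibly depending on $x,x'$) such that $f_i(x)\le f_i(x')$ for $i\in S$ and $f_i(x)\le(1+\varepsilon)f_i(x')$ for $i\notin S$. *)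

theory Defs
  imports Complex_Main "HOL-Analysis.Finite_Cartesian_Product"
begin

definition tri_instance :: "'a set \<Rightarrow> ('a \<Rightarrow> rat ^ 3) \<Rightarrow> bool" where
  "tri_instance X f \<longleftrightarrow> (\<forall>x\<in>X. \<forall>i. f x $ i > 0) \<and> finite (f ` X)"

text \<open>The objectives are rational, but \<open>\<epsilon>\<close> ranges over the reals.\<close>

definition approx_set :: "real \<Rightarrow> 'a set \<Rightarrow> ('a \<Rightarrow> rat ^ 3) \<Rightarrow> 'a set \<Rightarrow> bool" where
  "approx_set \<epsilon> X f P \<longleftrightarrow> P \<subseteq> X \<and>
     (\<forall>x'\<in>X. \<exists>x\<in>P. \<forall>i. real_of_rat (f x $ i) \<le> (1 + \<epsilon>) * real_of_rat (f x' $ i))"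

definition quasi_2_exact_approx_set ::
    "real \<Rightarrow> 'a set \<Rightarrow> ('a \<Rightarrow> rat ^ 3) \<Rightarrow> 'a set \<Rightarrow> bool" where
  "quasi_2_exact_approx_set \<epsilon> X f P \<longleftrightarrow> P \<subseteq> X \<and>
     (\<forall>x'\<in>X. \<exists>x\<in>P. \<exists>S :: 3 set. card S = 2 \<and>
        (\<forall>i\<in>S. f x $ i \<le> f x' $ i) \<and>
        (\<forall>i. i \<notin> S \<longrightarrow> real_of_rat (f x $ i) \<le> (1 + \<epsilon>) * real_of_rat (f x' $ i)))"

text \<open>Infinite sets are excluded explicitly because \<^const>\<open>card\<close> is 0 on them. Nothing is
  lost: since the image set of an instance is finite, choosing one solution per image point
  yields a finite set of either kind, so a set of minimum cardinality is always finite.\<close>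

definition min_card_set :: "('a set \<Rightarrow> bool) \<Rightarrow> 'a set \<Rightarrow> bool" where
  "min_card_set Q P \<longleftrightarrow> is_arg_min card (\<lambda>A. finite A \<and> Q A) P"

end

theory Submission
  imports Defs
begin

text \<open>Take points \<open>(N - k, N - k, M ^ k)\<close> for \<open>k = 0, \<dots>, n\<close>, with \<open>M > 1 + \<epsilon>\<close> and with
  \<open>N\<close> so large that \<open>N \<le> (1 + \<epsilon>) (N - n)\<close>. The point \<open>k = 0\<close> alone approximates all others.
  However, point \<open>j\<close> never covers point \<open>k \<noteq> j\<close> quasi-2-exactly: for \<open>j < k\<close> it is strictly worse
  in the first two objectives, and for \<open>j > k\<close> it is worse by more than \<open>1 + \<epsilon>\<close> in the third.\<close>

definition staircase :: "nat \<Rightarrow> nat \<Rightarrow> nat \<Rightarrow> rat ^ 3" where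
  "staircase N M k = (\<chi> i. if i = 3 then of_nat (M ^ k) else of_nat (N - k))"

lemma tri_instance_staircase:
  assumes "N > n" "M > 0"
  shows "tri_instance {..n} (staircase N M)"
  using assms by (auto simp: tri_instance_def staircase_def)

text \<open>The first two objectives are tightest at \<open>k = n\<close>, so the bound
  \<open>N\<close> there suffices for every \<open>k\<close>; in the third objective, point
  \<open>0\<close> already attains the minimum.\<close>

lemma approx_set_staircase:
  assumes "\<epsilon> > 0" "N > n" "M > 0" and N: "real N \<le> (1 + \<epsilon>) * real (N - n)"
  shows "approx_set \<epsilon> {..n} (staircase N M) {0}"
proof -
  have "real_of_rat (staircase N M 0 $ i) \<le> (1 + \<epsilon>) * real_of_rat (staircase N M k $ i)"
    if "k \<le> n" for k i
  proof (cases "i = 3")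
    case True
    \<comment> \<open>The left side is \<open>M ^ 0\<close>, split as a product so that
      \<open>mult_mono\<close> compares factor by factor.\<close>
    have "1 * 1 \<le> (1 + \<epsilon>) * real (M ^ k)"
      using assms by (intro mult_mono) auto
    then show ?thesis
      using True by (simp add: staircase_def of_rat_power)
  next
    case False
    have "(1 + \<epsilon>) * real (N - n) \<le> (1 + \<epsilon>) * real (N - k)"
      using \<open>\<epsilon> > 0\<close> \<open>k \<le> n\<close> by (intro mult_left_mono) auto
    then show ?thesis
      using False N by (simp add: staircase_def)
  qed
  then show ?thesis
    by (auto simp: approx_set_def)
qed

lemma staircase_not_quasi_2_exact:
  fixes S :: "3 set"
  assumes "\<epsilon> > 0" "real M > 1 + \<epsilon>" "k < N" "j \<noteq> k" "card S = 2"
    and exact: "\<forall>i\<in>S. staircase N M j $ i \<le> staircase N M k $ i"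
    and approx: "\<forall>i. i \<notin> S \<longrightarrow>
      real_of_rat (staircase N M j $ i) \<le> (1 + \<epsilon>) * real_of_rat (staircase N M k $ i)"
  shows False
proof (cases "j < k")
  case True
  \<comment> \<open>Two exact objectives cannot both be the third, so one of the two descending ones
    is compared exactly.\<close>
  have "\<not> S \<subseteq> {3}"
    using \<open>card S = 2\<close> card_mono[of "{3::3}" S] by auto
  then obtain i where "i \<in> S" "i \<noteq> 3"
    by auto
  with exact have "N - j \<le> N - k"
    by (auto simp: staircase_def)
  \<comment> \<open>Subtraction truncates at 0; \<open>k < N\<close> keeps \<open>N - k\<close>
    strictly below \<open>N - j\<close>.\<close>
  with True \<open>k < N\<close> show False
    by simp
next
  case False
  with \<open>j \<noteq> k\<close> have "Suc k \<le> j"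
    by simp
  have M: "real M > 1"
    using assms by simp
  then have pos: "real M ^ k > 0"
    by simp
  \<comment> \<open>A single extra factor \<open>M\<close> already exceeds the tolerance.\<close>
  have "(1 + \<epsilon>) * real M ^ k < real M * real M ^ k"
    using assms(2) pos by (intro mult_strict_right_mono)
  also have "\<dots> \<le> real M ^ j"
    using power_increasing[OF \<open>Suc k \<le> j\<close>, of "real M"] M by simp
  finally have gap: "(1 + \<epsilon>) * real M ^ k < real M ^ j" .
  \<comment> \<open>An exact comparison implies the approximate one, so the third objective obeys
    the same bound whether or not \<open>3 \<in> S\<close>.\<close>
  have "real M ^ k \<le> (1 + \<epsilon>) * real M ^ k"
    using pos \<open>\<epsilon> > 0\<close> by simp
  moreover have "real_of_rat (staircase N M j $ 3) \<le> real_of_rat (staircase N M k $ 3)" if "3 \<in> S"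
    using exact that by (auto simp: of_rat_less_eq)
  ultimately have "real M ^ j \<le> (1 + \<epsilon>) * real M ^ k"
    using approx by (cases "3 \<in> S") (auto simp: staircase_def of_rat_power)
  with gap show False
    by simp
qed

lemma quasi_2_exact_approx_set_staircase_iff:
  assumes "\<epsilon> > 0" "real M > 1 + \<epsilon>" "N > n"
  shows "quasi_2_exact_approx_set \<epsilon> {..n} (staircase N M) P \<longleftrightarrow> P = {..n}"
proof
  assume P: "quasi_2_exact_approx_set \<epsilon> {..n} (staircase N M) P"
  have "k \<in> P" if "k \<le> n" for k
  proof -
    obtain j and S :: "3 set" where "j \<in> P" "card S = 2"
      "\<forall>i\<in>S. staircase N M j $ i \<le> staircase N M k $ i"
      "\<forall>i. i \<notin> S \<longrightarrow>
        real_of_rat (staircase N M j $ i) \<le> (1 + \<epsilon>) * real_of_rat (staircase N M k $ i)"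
      using P \<open>k \<le> n\<close> unfolding quasi_2_exact_approx_set_def by (meson atMost_iff)
    moreover have "k < N"
      using that assms by simp
    ultimately have "j = k"
      using staircase_not_quasi_2_exact assms by blast
    with \<open>j \<in> P\<close> show ?thesis
      by simp
  qed
  moreover have "P \<subseteq> {..n}"
    using P by (simp add: quasi_2_exact_approx_set_def)
  ultimately show "P = {..n}"
    by auto
next
  assume "P = {..n}"
  \<comment> \<open>A witness for \<open>S\<close> when a point covers itself; any pair of
    objectives would do.\<close>
  moreover have "card {1, 2 :: 3} = 2"
    by simp
  moreover have "real_of_rat (staircase N M k $ i) \<le> (1 + \<epsilon>) * real_of_rat (staircase N M k $ i)"
    for k i
    using \<open>\<epsilon> > 0\<close> by (simp add: staircase_def distrib_right)
  ultimately show "quasi_2_exact_approx_set \<epsilon> {..n} (staircase N M) P"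
    unfolding quasi_2_exact_approx_set_def by blast
qed

lemma min_card_set_unique:
  assumes "finite A" "\<And>P. Q P \<longleftrightarrow> P = A"
  shows "min_card_set Q A"
  using assms by (simp add: min_card_set_def is_arg_min_def)

text \<open>The only finite set with fewer elements than a singleton is empty.\<close>

lemma min_card_set_singleton:
  assumes "Q {x}" "\<not> Q {}"
  shows "min_card_set Q {x}"
  using assms by (auto simp: min_card_set_def is_arg_min_def card_gt_0_iff)

theorem theorem4p5:
  fixes \<epsilon> :: real and n :: nat
  assumes "\<epsilon> > 0" and "n > 0"
  shows "\<exists>(X :: nat set) (f :: nat \<Rightarrow> rat ^ 3). tri_instance X f \<and>
           (\<exists>P2 P. min_card_set (quasi_2_exact_approx_set \<epsilon> X f) P2 \<and>
                   min_card_set (approx_set \<epsilon> X f) P \<and>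
                   card P2 > n * card P)"
proof -
  obtain M :: nat where M: "real M > 1 + \<epsilon>"
    using reals_Archimedean2 by blast
  with \<open>\<epsilon> > 0\<close> have "M > 0"
    by (cases M) auto
  \<comment> \<open>The threshold comes from solving \<open>N < (1 + \<epsilon>) * (N - n)\<close>
    for \<open>N\<close>; it also forces \<open>N > n\<close>.\<close>
  obtain N :: nat where N: "real N > (1 + \<epsilon>) * real n / \<epsilon>"
    using reals_Archimedean2 by blast
  then have N': "(1 + \<epsilon>) * real n < \<epsilon> * real N"
    using \<open>\<epsilon> > 0\<close> by (simp add: field_simps)
  then have "\<epsilon> * real n < \<epsilon> * real N"
    by (simp add: distrib_right)
  then have "N > n"
    using \<open>\<epsilon> > 0\<close> by simp
  have "real N \<le> (1 + \<epsilon>) * real (N - n)"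
    using N' \<open>N > n\<close> by (simp add: of_nat_diff algebra_simps)
  then have "approx_set \<epsilon> {..n} (staircase N M) {0}"
    using approx_set_staircase \<open>\<epsilon> > 0\<close> \<open>N > n\<close> \<open>M > 0\<close> by blast
  moreover have "\<not> approx_set \<epsilon> {..n} (staircase N M) {}"
    by (auto simp: approx_set_def)
  ultimately have "min_card_set (approx_set \<epsilon> {..n} (staircase N M)) {0}"
    by (rule min_card_set_singleton)
  moreover have "min_card_set (quasi_2_exact_approx_set \<epsilon> {..n} (staircase N M)) {..n}"
    using quasi_2_exact_approx_set_staircase_iff[OF \<open>\<epsilon> > 0\<close> M \<open>N > n\<close>]
    by (intro min_card_set_unique) auto
  \<comment> \<open>The range includes 0, so this reads \<open>n + 1 > n\<close>.\<close>
  moreover have "card {..n} > n * card {0::nat}"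
    by simp
  ultimately show ?thesis
    using tri_instance_staircase[OF \<open>N > n\<close> \<open>M > 0\<close>] by blast
qed

end
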